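(* Let $k$ be a positive integer and let $b_k(x)=\sum_{n=0}^{\infty}b_{k,n}x^n$ be the ordinary generating function (a formal power series in $x$) of the binomial transform $\{b_{k,n}\}_{n\ge0}$ of the higher order Mersenne sequence. Then $$b_k(x)=\frac{x}{1-(2+m_k)x+2m_kx^2} .$$
   Context: The Mersenne numbers $\{M_n\}_{n\ge 0}$ are defined by $M_0=0$, $M_1=1$, $M_{n+2}=3M_{n+1}-2M_n$, i.e. $M_n=2^n-1$. The Mersenne-Lucas numbers satisfy the same recurrence with $m_0=2$, $m_1=3$, i.e. $m_n=2^n+1$. For a positive integer $k$, the higher order Mersenne numbers are $M_n^{(k)}=M_{kn}/M_k$ for $n=0,1,2,\dots$, and their binomial transform is $b_{k,n}=\sum_{i=0}^{n}\binom{n}{i}M_i^{(k)}$ for $n\ge 0$. *)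

theory Defs
  imports "HOL-Computational_Algebra.Formal_Power_Series"
begin

fun mersenne :: "nat \<Rightarrow> int" where
  "mersenne 0 = 0"
| "mersenne (Suc 0) = 1"
| "mersenne (Suc (Suc n)) = 3 * mersenne (Suc n) - 2 * mersenne n"

fun mersenne_lucas :: "nat \<Rightarrow> int" where
  "mersenne_lucas 0 = 2"
| "mersenne_lucas (Suc 0) = 3"
| "mersenne_lucas (Suc (Suc n)) = 3 * mersenne_lucas (Suc n) - 2 * mersenne_lucas n"

lemma mersenne_closed_form: "mersenne n = 2 ^ n - 1"
  by (induction n rule: mersenne.induct) auto

lemma mersenne_lucas_closed_form: "mersenne_lucas n = 2 ^ n + 1"
  by (induction n rule: mersenne_lucas.induct) auto

text \<open>The quotient is taken in the rationals, and is meaningful for \<open>k > 0\<close>, where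
  \<open>mersenne k\<close> is nonzero.\<close>

definition higher_mersenne :: "nat \<Rightarrow> nat \<Rightarrow> rat" where
  "higher_mersenne k n = of_int (mersenne (k * n)) / of_int (mersenne k)"

definition binomial_transform :: "(nat \<Rightarrow> rat) \<Rightarrow> nat \<Rightarrow> rat" where
  "binomial_transform a n = (\<Sum>i=0..n. of_nat (n choose i) * a i)"

definition higher_mersenne_binomial_gf :: "nat \<Rightarrow> rat fps" where
  "higher_mersenne_binomial_gf k = Abs_fps (\<lambda>n. binomial_transform (higher_mersenne k) n)"

end

theory Submission
  imports Defs
begin

text \<open>Put q = \<open>2 ^ k\<close>. The higher order Mersenne numbers are (q^i - 1)/(q - 1),
  so the binomial theorem gives b_{k,n} = ((q+1)^n - 2^n)/(q - 1)
  (\<open>binomial_transform_higher_mersenne\<close>). Since m_k = q + 1, the bases 2 and m_k are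
  the roots of t^2 - (2 + m_k) t + 2 m_k, which yields a second-order recurrence
  (\<open>quotient_recurrence\<close>). With initial values 0 and 1 it determines the generating
  function (\<open>fps_eq_of_linear_recurrence2\<close>).\<close>

unbundle fps_syntax

text \<open>In the product of \<open>f\<close> with the denominator, the recurrence kills every
  coefficient from degree 2 on and the initial values leave \<open>fps_X\<close>. The denominator
  has constant term 1, so it can be cancelled.\<close>

lemma fps_eq_of_linear_recurrence2:
  fixes f :: "'a::field fps"
  assumes "f $ 0 = 0" "f $ 1 = 1"
    and rec: "\<And>n. f $ (n + 2) = c * f $ (n + 1) - d * f $ n"
  shows "f = fps_X / (1 - fps_const c * fps_X + fps_const d * fps_X ^ 2)"
proof -
  let ?D = "1 - fps_const c * fps_X + fps_const d * fps_X ^ 2"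
  \<comment> \<open>In this form each factor \<open>fps_X\<close> is a shift of the index, so
    coefficients can be read off.\<close>
  have D: "f * ?D = f - fps_const c * (fps_X * f) + fps_const d * (fps_X * (fps_X * f))"
    by (simp add: algebra_simps power2_eq_square)
  have "f * ?D = fps_X"
  proof (rule fps_ext)
    fix n :: nat
    consider "n = 0" | "n = 1" | m where "n = m + 2"
      by (metis One_nat_def add_2_eq_Suc' not0_implies_Suc)
    then show "(f * ?D) $ n = fps_X $ n"
      unfolding D using assms(1,2) rec by cases simp_all
  qed
  moreover have "?D $ 0 \<noteq> 0"
    by simp
  then have "?D \<noteq> 0"
    by (metis fps_zero_nth)
  ultimately show ?thesis
    using nonzero_mult_div_cancel_right[of ?D f] by simp
qed

text \<open>The binomial theorem is applied to the powers of \<open>2 ^ k\<close> and of 1. For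
  \<open>k = 0\<close> both sides are 0, by division by zero.\<close>

lemma binomial_transform_higher_mersenne:
  "binomial_transform (higher_mersenne k) n = ((2 ^ k + 1) ^ n - 2 ^ n) / (2 ^ k - 1)"
proof -
  have "binomial_transform (higher_mersenne k) n =
      (\<Sum>i\<le>n. of_nat (n choose i) * (2 ^ k) ^ i - of_nat (n choose i)) / (2 ^ k - 1)"
    by (simp add: binomial_transform_def higher_mersenne_def mersenne_closed_form
        atLeast0AtMost sum_divide_distrib power_mult right_diff_distrib)
  \<comment> \<open>Writing 2 as \<open>1 + 1\<close> makes the sum of bare binomial coefficients an
    instance of the binomial theorem too.\<close>
  also have "\<dots> = ((2 ^ k + 1) ^ n - (1 + 1) ^ n) / (2 ^ k - 1)"
    by (simp only: binomial_ring sum_subtractf power_one mult_1_right)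
  finally show ?thesis by simp
qed

text \<open>Both 2 and \<open>q + 1\<close> are roots of the characteristic polynomial (t - 2)(t -
  (q + 1)), and the recurrence is linear, so it survives the difference and the division by
  \<open>q - 1\<close>.\<close>

lemma quotient_recurrence:
  fixes q :: "'a::field"
  shows "((q + 1) ^ (n + 2) - 2 ^ (n + 2)) / (q - 1) =
    (2 + (q + 1)) * (((q + 1) ^ (n + 1) - 2 ^ (n + 1)) / (q - 1))
    - 2 * (q + 1) * (((q + 1) ^ n - 2 ^ n) / (q - 1))"
proof -
  have "x ^ (n + 2) - 2 ^ (n + 2) =
      (2 + x) * (x ^ (n + 1) - 2 ^ (n + 1)) - 2 * x * (x ^ n - 2 ^ n)" for x :: 'a
    by (simp add: algebra_simps)
  from this[of "q + 1"] show ?thesis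
    by (simp only: times_divide_eq_right flip: diff_divide_distrib)
qed

theorem theorem2p24:
  fixes k :: nat
  assumes "k > 0"
  shows "higher_mersenne_binomial_gf k =
    fps_X / (1 - fps_const (2 + of_int (mersenne_lucas k)) * fps_X
               + fps_const (2 * of_int (mersenne_lucas k)) * fps_X ^ 2)"
proof (rule fps_eq_of_linear_recurrence2)
  \<comment> \<open>Positivity of \<open>k\<close> enters here: the coefficient at 1 is (q - 1)/(q -
    1), which equals 1 only if q differs from 1.\<close>
  have "(2::rat) ^ k \<noteq> 1"
    using assms power_inject_exp[of "2::rat" k 0] by simp
  then show "higher_mersenne_binomial_gf k $ 1 = 1"
    by (simp add: higher_mersenne_binomial_gf_def binomial_transform_higher_mersenne)
  show "higher_mersenne_binomial_gf k $ 0 = 0"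
    by (simp add: higher_mersenne_binomial_gf_def binomial_transform_higher_mersenne)
  fix n
  show "higher_mersenne_binomial_gf k $ (n + 2) =
      (2 + of_int (mersenne_lucas k)) * higher_mersenne_binomial_gf k $ (n + 1)
      - 2 * of_int (mersenne_lucas k) * higher_mersenne_binomial_gf k $ n"
    unfolding higher_mersenne_binomial_gf_def fps_nth_Abs_fps
      binomial_transform_higher_mersenne mersenne_lucas_closed_form
    using quotient_recurrence[of "2 ^ k" n]
    by (simp only: of_int_add of_int_power of_int_numeral of_int_1)
qed

end
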